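(* For any infinite set $\Gamma$, there is a weak$^\ast$-to-weak$^\ast$ homeomorphism $f:B_{\ell_1(\Gamma)^\ast}\to B_{\ell_1(\Gamma)^\ast}$ which is not norm-to-norm continuous and does not preserve the limit of norms of weak$^\ast$ convergent sequences, i.e. there is a sequence $(x_n^\ast)$ in $B_{\ell_1(\Gamma)^\ast}$ weak$^\ast$ converging to some $x^\ast$ with $\|x_n^\ast\|\to\|x^\ast\|$ but such that $\|f(x_n^\ast)\|$ does not converge to $\|f(x^\ast)\|$.
   Context: $\ell_1(\Gamma)$ is the real Banach space of absolutely summable families indexed by $\Gamma$, and $B_{\ell_1(\Gamma)^\ast}$ is the closed unit ball of its dual $\ell_1(\Gamma)^\ast=\ell_\infty(\Gamma)$; this ball is identified with $[-1,1]^\Gamma$, with the weak$^\ast$ topology corresponding to the pointwise (product) topology. *)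

theory Defs
  imports "HOL-Analysis.Analysis"
begin

text \<open>
  The index set is the universe of the type \<open>'g\<close>.
\<close>

typedef 'g ell1 = "{x :: 'g \<Rightarrow> real. (\<lambda>i. \<bar>x i\<bar>) summable_on UNIV}"
  morphisms ell1_nth Abs_ell1
  by (rule exI[of _ "\<lambda>_. 0"]) simp

setup_lifting type_definition_ell1

lemma ell1_eqI: "(\<And>i. ell1_nth x i = ell1_nth y i) \<Longrightarrow> x = y"
  by (simp add: ell1_nth_inject[symmetric] fun_eq_iff)

lemma ell1_abs_summable: "(\<lambda>i. \<bar>ell1_nth x i\<bar>) summable_on UNIV"
  using ell1_nth[of x] by simp

lemma abs_summable_dominated:
  fixes f g :: "'g \<Rightarrow> real"
  assumes "g summable_on UNIV" and "\<And>i. \<bar>f i\<bar> \<le> g i"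
  shows "(\<lambda>i. \<bar>f i\<bar>) summable_on UNIV"
  using Infinite_Sum.abs_summable_on_comparison_test'[of g UNIV f] assms by simp

instantiation ell1 :: (type) real_normed_vector
begin

lift_definition zero_ell1 :: "'a ell1" is "\<lambda>_. 0"
  by simp

lift_definition plus_ell1 :: "'a ell1 \<Rightarrow> 'a ell1 \<Rightarrow> 'a ell1" is "\<lambda>x y i. x i + y i"
  subgoal for x y
    by (rule abs_summable_dominated[of "\<lambda>i. \<bar>x i\<bar> + \<bar>y i\<bar>"])
      (auto intro: summable_on_add abs_triangle_ineq)
  done

lift_definition minus_ell1 :: "'a ell1 \<Rightarrow> 'a ell1 \<Rightarrow> 'a ell1" is "\<lambda>x y i. x i - y i"
  subgoal for x y
    by (rule abs_summable_dominated[of "\<lambda>i. \<bar>x i\<bar> + \<bar>y i\<bar>"])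
      (auto intro: summable_on_add abs_triangle_ineq4)
  done

lift_definition uminus_ell1 :: "'a ell1 \<Rightarrow> 'a ell1" is "\<lambda>x i. - x i"
  by simp

lift_definition scaleR_ell1 :: "real \<Rightarrow> 'a ell1 \<Rightarrow> 'a ell1" is "\<lambda>c x i. c * x i"
  by (simp add: abs_mult summable_on_cmult_right)

lift_definition norm_ell1 :: "'a ell1 \<Rightarrow> real" is "\<lambda>x. \<Sum>\<^sub>\<infinity>i. \<bar>x i\<bar>" .

definition "sgn_ell1 (x :: 'a ell1) = inverse (norm x) *\<^sub>R x"

definition "dist_ell1 (x :: 'a ell1) y = norm (x - y)"

definition "(uniformity :: ('a ell1 \<times> 'a ell1) filter) = (INF e\<in>{0<..}. principal {(x, y). dist x y < e})"

definition "open_ell1 (U :: 'a ell1 set) \<longleftrightarrow> (\<forall>x\<in>U. \<forall>\<^sub>F (x', y) in uniformity. x' = x \<longrightarrow> y \<in> U)"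

instance
proof
  fix x y z :: "'a ell1" and a b :: real
  show "x + y + z = x + (y + z)" by transfer (simp add: add.assoc)
  show "x + y = y + x" by transfer (simp add: add.commute)
  show "0 + x = x" by transfer simp
  show "- x + x = 0" by transfer simp
  show "x - y = x + - y" by transfer simp
  show "a *\<^sub>R (x + y) = a *\<^sub>R x + a *\<^sub>R y" by transfer (simp add: distrib_left)
  show "(a + b) *\<^sub>R x = a *\<^sub>R x + b *\<^sub>R x" by transfer (simp add: distrib_right)
  show "a *\<^sub>R b *\<^sub>R x = (a * b) *\<^sub>R x" by transfer (simp add: mult.assoc)
  show "1 *\<^sub>R x = x" by transfer simp
  show "dist x y = norm (x - y)" by (rule dist_ell1_def)
  show "sgn x = inverse (norm x) *\<^sub>R x" by (rule sgn_ell1_def)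
  show "(uniformity :: ('a ell1 \<times> 'a ell1) filter) = (INF e\<in>{0<..}. principal {(x, y). dist x y < e})"
    by (rule uniformity_ell1_def)
  show "open U \<longleftrightarrow> (\<forall>x\<in>U. \<forall>\<^sub>F (x', y) in uniformity. x' = x \<longrightarrow> y \<in> U)" for U :: "'a ell1 set"
    by (rule open_ell1_def)
  show "norm x = 0 \<longleftrightarrow> x = 0"
  proof
    assume "norm x = 0"
    then have "\<bar>ell1_nth x i\<bar> = 0" for i
      by (intro nonneg_infsum_le_0D[of "\<lambda>i. \<bar>ell1_nth x i\<bar>" UNIV])
        (auto simp: norm_ell1.rep_eq ell1_abs_summable)
    then show "x = 0" by (intro ell1_eqI) (simp add: zero_ell1.rep_eq)
  qed (simp add: norm_ell1.rep_eq zero_ell1.rep_eq)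
  show "norm (x + y) \<le> norm x + norm y"
    unfolding norm_ell1.rep_eq plus_ell1.rep_eq
      infsum_add[OF ell1_abs_summable ell1_abs_summable, symmetric]
    using ell1_abs_summable[of "x + y"]
    by (intro infsum_mono summable_on_add ell1_abs_summable)
      (auto simp: plus_ell1.rep_eq intro: abs_triangle_ineq)
  show "norm (a *\<^sub>R x) = \<bar>a\<bar> * norm x"
    by (simp add: norm_ell1.rep_eq scaleR_ell1.rep_eq abs_mult infsum_cmult_right')
qed

end

lemma ell1_finite_sum_le_norm: "finite F \<Longrightarrow> (\<Sum>i\<in>F. \<bar>ell1_nth x i\<bar>) \<le> norm x"
  unfolding norm_ell1.rep_eq by (rule finite_sum_le_infsum[OF ell1_abs_summable]) auto

lemma ell1_nth_le_norm: "\<bar>ell1_nth x i\<bar> \<le> norm x"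
  using ell1_finite_sum_le_norm[of "{i}" x] by simp

instance ell1 :: (type) banach
proof
  fix X :: "nat \<Rightarrow> 'a ell1"
  assume X: "Cauchy X"
  have "Cauchy (\<lambda>n. ell1_nth (X n) i)" for i
  proof (rule metric_CauchyI)
    fix e :: real assume "0 < e"
    then obtain M where M: "\<And>m n. m \<ge> M \<Longrightarrow> n \<ge> M \<Longrightarrow> dist (X m) (X n) < e"
      using metric_CauchyD[OF X] by blast
    have "dist (ell1_nth (X m) i) (ell1_nth (X n) i) < e" if "m \<ge> M" "n \<ge> M" for m n
      using ell1_nth_le_norm[of "X m - X n" i] M[OF that]
      by (simp add: dist_norm minus_ell1.rep_eq)
    then show "\<exists>M. \<forall>m\<ge>M. \<forall>n\<ge>M. dist (ell1_nth (X m) i) (ell1_nth (X n) i) < e" by blast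
  qed
  then have "\<forall>i. \<exists>a. (\<lambda>n. ell1_nth (X n) i) \<longlonglongrightarrow> a"
    by (simp add: Cauchy_convergent_iff convergent_def)
  from choice[OF this]
  obtain l where l: "\<And>i. (\<lambda>n. ell1_nth (X n) i) \<longlonglongrightarrow> l i"
    by blast
  have bound: "(\<Sum>i\<in>F. \<bar>ell1_nth (X n) i - l i\<bar>) \<le> e"
    if "finite F" "\<And>m. m \<ge> M \<Longrightarrow> dist (X n) (X m) \<le> e" for F n M e
  proof (rule tendsto_upperbound)
    show "(\<lambda>m. \<Sum>i\<in>F. \<bar>ell1_nth (X n) i - ell1_nth (X m) i\<bar>)
        \<longlonglongrightarrow> (\<Sum>i\<in>F. \<bar>ell1_nth (X n) i - l i\<bar>)"
      by (intro tendsto_intros l)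
    show "\<forall>\<^sub>F m in sequentially. (\<Sum>i\<in>F. \<bar>ell1_nth (X n) i - ell1_nth (X m) i\<bar>) \<le> e"
      using eventually_ge_at_top[of M]
    proof eventually_elim
      case (elim m)
      then show ?case
        using ell1_finite_sum_le_norm[OF that(1), of "X n - X m"] that(2)[of m]
        by (simp add: dist_norm minus_ell1.rep_eq)
    qed
  qed simp
  have ex: "\<exists>M. \<forall>n\<ge>M. \<forall>m\<ge>M. dist (X n) (X m) \<le> e" if "0 < e" for e
    using metric_CauchyD[OF X that] less_imp_le by blast
  obtain N where N: "\<And>m. m \<ge> N \<Longrightarrow> dist (X N) (X m) \<le> 1"
    using ex[of 1] by auto
  have "(\<lambda>i. \<bar>ell1_nth (X N) i - l i\<bar>) summable_on UNIV"
    by (rule nonneg_bdd_above_summable_on) (auto intro!: bdd_aboveI2[where M = 1] bound N)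
  from abs_summable_dominated[OF summable_on_add[OF this ell1_abs_summable[of "X N"]], of l]
  have "(\<lambda>i. \<bar>l i\<bar>) summable_on UNIV" by linarith
  then have L: "ell1_nth (Abs_ell1 l) = l"
    by (simp add: Abs_ell1_inverse)
  have "X \<longlonglongrightarrow> Abs_ell1 l"
  proof (rule metric_LIMSEQ_I)
    fix e :: real assume "0 < e"
    then obtain M where M: "\<And>n m. n \<ge> M \<Longrightarrow> m \<ge> M \<Longrightarrow> dist (X n) (X m) \<le> e / 2"
      using ex[of "e / 2"] by auto
    have "dist (X n) (Abs_ell1 l) \<le> e / 2" if "n \<ge> M" for n
      unfolding dist_norm norm_ell1.rep_eq
      using bound[OF _ M[OF that]] ell1_abs_summable[of "X n - Abs_ell1 l"]
      by (intro infsum_le_finite_sums) (auto simp: minus_ell1.rep_eq L)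
    then show "\<exists>M. \<forall>n\<ge>M. dist (X n) (Abs_ell1 l) < e"
      using \<open>0 < e\<close> by (intro exI[of _ M]) force
  qed
  then show "convergent X" by (rule convergentI)
qed

type_synonym 'g ell1_dual = "'g ell1 \<Rightarrow>\<^sub>L real"

text \<open>
  For functionals, the strong operator topology (pointwise convergence on the domain)
  is by definition the weak-star topology of the dual.
\<close>

abbreviation weak_star_topology :: "('a::real_normed_vector \<Rightarrow>\<^sub>L real) topology" where
  "weak_star_topology \<equiv> strong_operator_topology"

definition weak_star_ball :: "'g ell1_dual topology" where
  "weak_star_ball = subtopology weak_star_topology (cball 0 1)"

end

theory Submission
  imports Defs
begin

text \<open>
  A functional on \<open>ell1\<close> is determined by its values on the unit vectors, so on the dual ball
  the weak-star topology is that of coordinatewise convergence and any choice of homeomorphisms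
  of \<open>[-1, 1]\<close>, one for each coordinate, yields a weak-star homeomorphism of the ball. Choosing
  the homeomorphisms not equicontinuous at \<open>0\<close>, namely the \<open>(n + 1)\<close>-st root (extended as an odd
  function) on the \<open>n\<close>-th coordinate of a countable subset of the index set, the functionals whose
  only nonzero coordinate is \<open>(1 / 2) ^ (n + 1)\<close> at position \<open>n\<close> converge to \<open>0\<close> in norm, while
  their images have norm at least \<open>1 / 2\<close>.
\<close>

section \<open>Unit vectors and the expansion of an element along them\<close>

lift_definition ell1_unit :: "'g \<Rightarrow> 'g ell1" is "\<lambda>i j. if j = i then 1 else 0"
proof -
  fix i :: 'g
  have "(\<lambda>j. \<bar>if j = i then 1 else 0 :: real\<bar>) summable_on {i}"
    by simp
  then show "(\<lambda>j. \<bar>if j = i then 1 else 0 :: real\<bar>) summable_on UNIV"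
    by (rule summable_on_cong_neutral[THEN iffD1, rotated -1]) auto
qed

lemma norm_ell1_unit [simp]: "norm (ell1_unit i) = 1"
proof -
  have "norm (ell1_unit i) = (\<Sum>\<^sub>\<infinity>j\<in>{i}. 1)"
    unfolding norm_ell1.rep_eq ell1_unit.rep_eq
    by (rule infsum_cong_neutral) auto
  then show ?thesis by simp
qed

lemma ell1_nth_sum: "ell1_nth (\<Sum>i\<in>F. f i) j = (\<Sum>i\<in>F. ell1_nth (f i) j)"
  by (induction F rule: infinite_finite_induct) (auto simp: zero_ell1.rep_eq plus_ell1.rep_eq)

text \<open>The error left by a finite set of coordinates has as its norm the tail of the absolute
  sum, which is small once the set is large. Summation is unordered because the index set may be
  uncountable.\<close>

lemma has_sum_ell1_unit: "((\<lambda>i. ell1_nth x i *\<^sub>R ell1_unit i) has_sum x) UNIV"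
  unfolding has_sum_def tendsto_iff eventually_finite_subsets_at_top
proof (intro allI impI)
  fix e :: real assume "e > 0"
  have "((\<lambda>i. \<bar>ell1_nth x i\<bar>) has_sum norm x) UNIV"
    unfolding norm_ell1.rep_eq by (rule has_sum_infsum[OF ell1_abs_summable])
  then obtain G where G: "finite G"
    "\<And>F. finite F \<Longrightarrow> G \<subseteq> F \<Longrightarrow> dist (\<Sum>i\<in>F. \<bar>ell1_nth x i\<bar>) (norm x) < e"
    using \<open>e > 0\<close> unfolding has_sum_def tendsto_iff eventually_finite_subsets_at_top
    by (metis subset_UNIV)
  have "dist (\<Sum>i\<in>F. ell1_nth x i *\<^sub>R ell1_unit i) x < e" if F: "finite F" "G \<subseteq> F" for F
  proof -
    define y where "y = x - (\<Sum>i\<in>F. ell1_nth x i *\<^sub>R ell1_unit i)"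
    have y: "ell1_nth y j = (if j \<in> F then 0 else ell1_nth x j)" for j
      using F(1) by (simp add: y_def minus_ell1.rep_eq ell1_nth_sum scaleR_ell1.rep_eq
          ell1_unit.rep_eq if_distrib cong: if_cong)
    have "norm y = (\<Sum>\<^sub>\<infinity>j\<in>UNIV - F. \<bar>ell1_nth x j\<bar>)"
      unfolding norm_ell1.rep_eq by (rule infsum_cong_neutral) (auto simp: y)
    also have "\<dots> = norm x - (\<Sum>j\<in>F. \<bar>ell1_nth x j\<bar>)"
      using F(1) by (subst infsum_Diff) (auto simp: norm_ell1.rep_eq ell1_abs_summable)
    also have "\<dots> < e"
      using G(2)[OF F] by (simp add: dist_real_def)
    finally show ?thesis
      by (simp add: y_def dist_norm norm_minus_commute)
  qed
  then show "\<exists>X. finite X \<and> X \<subseteq> UNIV \<and> (\<forall>Y. finite Y \<and> X \<subseteq> Y \<and> Y \<subseteq> UNIV \<longrightarrow>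
      dist (\<Sum>i\<in>Y. ell1_nth x i *\<^sub>R ell1_unit i) x < e)"
    using G(1) by blast
qed

text \<open>A bounded functional commutes with the norm-convergent expansion along the unit vectors,
  so its values there determine it.\<close>

lemma ell1_dual_eqI:
  fixes \<phi> \<psi> :: "'g ell1_dual"
  assumes "\<And>i. blinfun_apply \<phi> (ell1_unit i) = blinfun_apply \<psi> (ell1_unit i)"
  shows "\<phi> = \<psi>"
proof (rule blinfun_eqI)
  fix x :: "'g ell1"
  have *: "((\<lambda>i. ell1_nth x i * blinfun_apply \<xi> (ell1_unit i)) has_sum blinfun_apply \<xi> x) UNIV"
    for \<xi> :: "'g ell1_dual"
    using has_sum_bounded_linear[OF blinfun.bounded_linear_right has_sum_ell1_unit, of \<xi> x]
    by (simp add: blinfun.scaleR_right)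
  show "blinfun_apply \<phi> x = blinfun_apply \<psi> x"
    using has_sum_unique[OF *[of \<phi>]] *[of \<psi>] assms by simp
qed

section \<open>Functionals given by bounded families\<close>

definition ell1_functional :: "('g \<Rightarrow> real) \<Rightarrow> 'g ell1_dual" where
  "ell1_functional a = Blinfun (\<lambda>x. \<Sum>\<^sub>\<infinity>i. a i * ell1_nth x i)"

context
  fixes a :: "'g \<Rightarrow> real" and C :: real
  assumes bound: "\<And>i. \<bar>a i\<bar> \<le> C"
begin

text \<open>This domination yields summability below and, with \<open>C\<close> equal to 1, the
  majorant for uniform convergence on the dual ball.\<close>

lemma bounded_mult_ell1_nth:
  "\<bar>a i * ell1_nth x i\<bar> \<le> C * \<bar>ell1_nth x i\<bar>"
  by (simp add: abs_mult bound mult_right_mono)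

lemma bounded_mult_ell1_abs_summable: "(\<lambda>i. \<bar>a i * ell1_nth x i\<bar>) summable_on UNIV"
  by (rule abs_summable_dominated[where g = "\<lambda>i. C * \<bar>ell1_nth x i\<bar>"])
    (auto intro: summable_on_cmult_right ell1_abs_summable bounded_mult_ell1_nth)

lemma bounded_mult_ell1_summable: "(\<lambda>i. a i * ell1_nth x i) summable_on UNIV"
  using abs_summable_summable[of "\<lambda>i. a i * ell1_nth x i" UNIV] bounded_mult_ell1_abs_summable
  by simp

lemma abs_infsum_mult_ell1_le: "\<bar>\<Sum>\<^sub>\<infinity>i. a i * ell1_nth x i\<bar> \<le> C * norm x"
proof -
  have "((\<lambda>i. C * \<bar>ell1_nth x i\<bar>) has_sum C * norm x) UNIV"
    unfolding norm_ell1.rep_eq by (intro has_sum_cmult_right has_sum_infsum ell1_abs_summable)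
  from norm_infsum_le[OF has_sum_infsum[OF bounded_mult_ell1_summable] this]
  show ?thesis using bounded_mult_ell1_nth by simp
qed

text \<open>\<open>Blinfun\<close> returns the intended map only for bounded linear arguments; the
  bound \<open>C\<close> on the family supplies boundedness, and the summability needed for
  additivity.\<close>

lemma ell1_functional_apply:
  "blinfun_apply (ell1_functional a) x = (\<Sum>\<^sub>\<infinity>i. a i * ell1_nth x i)"
proof -
  have "bounded_linear (\<lambda>x. \<Sum>\<^sub>\<infinity>i. a i * ell1_nth x i)"
  proof (rule bounded_linear_intro[where K = C])
    fix x y :: "'g ell1" and r :: real
    show "(\<Sum>\<^sub>\<infinity>i. a i * ell1_nth (x + y) i) =
        (\<Sum>\<^sub>\<infinity>i. a i * ell1_nth x i) + (\<Sum>\<^sub>\<infinity>i. a i * ell1_nth y i)"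
      by (simp add: plus_ell1.rep_eq distrib_left infsum_add bounded_mult_ell1_summable)
    show "(\<Sum>\<^sub>\<infinity>i. a i * ell1_nth (r *\<^sub>R x) i) = r *\<^sub>R (\<Sum>\<^sub>\<infinity>i. a i * ell1_nth x i)"
      by (simp add: scaleR_ell1.rep_eq infsum_cmult_right' mult.left_commute)
    show "norm (\<Sum>\<^sub>\<infinity>i. a i * ell1_nth x i) \<le> norm x * C"
      using abs_infsum_mult_ell1_le by (simp add: mult.commute)
  qed
  then show ?thesis
    by (simp add: ell1_functional_def bounded_linear_Blinfun_apply)
qed

lemma ell1_functional_unit: "blinfun_apply (ell1_functional a) (ell1_unit i) = a i"
proof -
  have "(\<Sum>\<^sub>\<infinity>j. a j * ell1_nth (ell1_unit i) j) = (\<Sum>\<^sub>\<infinity>j\<in>{i}. a j)"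
    by (rule infsum_cong_neutral) (auto simp: ell1_unit.rep_eq)
  then show ?thesis by (simp add: ell1_functional_apply)
qed

lemma norm_ell1_functional_le: "norm (ell1_functional a) \<le> C"
proof (rule norm_blinfun_bound)
  show "0 \<le> C" using bound abs_ge_zero order_trans by blast
  show "norm (blinfun_apply (ell1_functional a) x) \<le> C * norm x" for x
    using abs_infsum_mult_ell1_le by (simp add: ell1_functional_apply)
qed

end

section \<open>Coordinatewise maps of the dual ball\<close>

lemma abs_apply_ell1_unit_le: "\<bar>blinfun_apply \<phi> (ell1_unit i)\<bar> \<le> norm \<phi>"
  using norm_blinfun[of \<phi> "ell1_unit i"] by simp

lemma topspace_weak_star_ball [simp]: "topspace weak_star_ball = cball 0 1"
  by (simp add: weak_star_ball_def strong_operator_topology_topspace)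

definition coordinatewise :: "('g \<Rightarrow> real \<Rightarrow> real) \<Rightarrow> 'g ell1_dual \<Rightarrow> 'g ell1_dual" where
  "coordinatewise p \<phi> = ell1_functional (\<lambda>i. p i (blinfun_apply \<phi> (ell1_unit i)))"

context
  fixes p :: "'g \<Rightarrow> real \<Rightarrow> real"
  assumes maps: "\<And>i t. \<bar>t\<bar> \<le> 1 \<Longrightarrow> \<bar>p i t\<bar> \<le> 1"
begin

lemma coordinatewise_bound:
  assumes "norm \<phi> \<le> 1"
  shows "\<bar>p i (blinfun_apply \<phi> (ell1_unit i))\<bar> \<le> 1"
  by (rule maps) (rule order_trans[OF abs_apply_ell1_unit_le assms])

lemma coordinatewise_unit:
  "norm \<phi> \<le> 1 \<Longrightarrow>
    blinfun_apply (coordinatewise p \<phi>) (ell1_unit i) = p i (blinfun_apply \<phi> (ell1_unit i))"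
  unfolding coordinatewise_def by (rule ell1_functional_unit[OF coordinatewise_bound])

lemma norm_coordinatewise_le: "norm \<phi> \<le> 1 \<Longrightarrow> norm (coordinatewise p \<phi>) \<le> 1"
  unfolding coordinatewise_def by (rule norm_ell1_functional_le[OF coordinatewise_bound])

text \<open>Evaluated at a fixed \<open>x\<close>, the image is a series of weak-star continuous
  terms that converges uniformly on the ball. Summability of \<open>x\<close> makes up for a
  possible lack of equicontinuity of the \<open>p i\<close>.\<close>

lemma continuous_map_coordinatewise:
  assumes cont: "\<And>i. continuous_on UNIV (p i)"
  shows "continuous_map weak_star_ball weak_star_ball (coordinatewise p)"
proof -
  have eval: "continuous_map weak_star_ball euclidean (\<lambda>\<phi>. blinfun_apply \<phi> y)" for y :: "'g ell1"
    unfolding weak_star_ball_def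
    by (rule continuous_map_from_subtopology[OF strong_operator_topology_continuous_evaluation])
  have "continuous_map weak_star_ball euclidean (\<lambda>\<phi>. blinfun_apply (coordinatewise p \<phi>) x)" for x
  proof -
    define f where "f i \<phi> = p i (blinfun_apply \<phi> (ell1_unit i)) * ell1_nth x i" for i \<phi>
    have "continuous_map weak_star_ball euclidean (f i)" for i
      unfolding f_def
      using continuous_map_compose[OF eval[of "ell1_unit i"], of euclidean "p i"] cont
      by (intro continuous_map_real_mult) (simp_all add: o_def)
    then have sums: "continuous_map weak_star_ball euclidean (\<lambda>\<phi>. \<Sum>i\<in>F. f i \<phi>)" if "finite F" for F
      using that by (intro continuous_map_sum) auto
    \<comment> \<open>Each term is at most \<open>\<bar>ell1_nth x i\<bar>\<close>, whatever the
      functional in the ball, so the Weierstrass test applies along the net of finite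
      subsets.\<close>
    have "uniform_limit (cball 0 1) (\<lambda>F \<phi>. \<Sum>i\<in>F. f i \<phi>) (\<lambda>\<phi>. \<Sum>\<^sub>\<infinity>i. f i \<phi>)
        (finite_subsets_at_top UNIV)"
      using bounded_mult_ell1_nth[OF coordinatewise_bound]
      by (intro Weierstrass_m_test_general[where M = "\<lambda>i. \<bar>ell1_nth x i\<bar>"] ell1_abs_summable)
        (simp add: f_def)
    then have "continuous_map weak_star_ball Met_TC.mtopology (\<lambda>\<phi>. \<Sum>\<^sub>\<infinity>i. f i \<phi>)"
      using sums
      by (intro Met_TC.continuous_map_uniform_limit[where F = "finite_subsets_at_top UNIV"
            and f = "\<lambda>F \<phi>. \<Sum>i\<in>F. f i \<phi>"])
        (auto simp: uniform_limit_iff)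
    moreover have "blinfun_apply (coordinatewise p \<phi>) x = (\<Sum>\<^sub>\<infinity>i. f i \<phi>)" if "norm \<phi> \<le> 1" for \<phi>
      unfolding coordinatewise_def f_def
      by (rule ell1_functional_apply[OF coordinatewise_bound[OF that]])
    ultimately show ?thesis
      by - (rule continuous_map_eq[where f = "\<lambda>\<phi>. \<Sum>\<^sub>\<infinity>i. f i \<phi>"], simp_all)
  qed
  \<comment> \<open>The weak-star topology is the initial one for the evaluations, so treating each
    \<open>x\<close> separately suffices.\<close>
  then have "continuous_map weak_star_ball weak_star_topology (coordinatewise p)"
    by (simp add: continuous_on_strong_operator_topo_iff_coordinatewise)
  then show ?thesis
    using norm_coordinatewise_le
    by (subst (2) weak_star_ball_def) (auto simp: continuous_map_in_subtopology)
qed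

end

lemma coordinatewise_inverse:
  assumes "\<And>i t. \<bar>t\<bar> \<le> 1 \<Longrightarrow> \<bar>p i t\<bar> \<le> 1" "\<And>i t. \<bar>t\<bar> \<le> 1 \<Longrightarrow> \<bar>q i t\<bar> \<le> 1"
    and "\<And>i t. q i (p i t) = t" and "norm \<phi> \<le> 1"
  shows "coordinatewise q (coordinatewise p \<phi>) = \<phi>"
  by (rule ell1_dual_eqI)
    (simp add: coordinatewise_unit[of q] coordinatewise_unit[of p] norm_coordinatewise_le[of p] assms)

lemma homeomorphic_map_coordinatewise:
  assumes "\<And>i t. \<bar>t\<bar> \<le> 1 \<Longrightarrow> \<bar>p i t\<bar> \<le> 1" "\<And>i t. \<bar>t\<bar> \<le> 1 \<Longrightarrow> \<bar>q i t\<bar> \<le> 1"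
    and "\<And>i t. q i (p i t) = t" "\<And>i t. p i (q i t) = t"
    and "\<And>i. continuous_on UNIV (p i)" "\<And>i. continuous_on UNIV (q i)"
  shows "homeomorphic_map weak_star_ball weak_star_ball (coordinatewise p)"
proof -
  have "homeomorphic_maps weak_star_ball weak_star_ball (coordinatewise p) (coordinatewise q)"
    unfolding homeomorphic_maps_def
    using assms
    by (auto intro!: continuous_map_coordinatewise coordinatewise_inverse)
  then show ?thesis by (rule homeomorphic_map_maps[THEN iffD2, OF exI])
qed

section \<open>Odd extensions of powers as inverses of roots\<close>

lemma root_Suc_mult_abs_power: "root (Suc n) (t * \<bar>t\<bar> ^ n) = t"
proof -
  \<comment> \<open>The signed power is odd for every degree, just as \<open>root\<close> is, so the
    two are inverse on the whole line even when \<open>Suc n\<close> is even.\<close>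
  have "t * \<bar>t\<bar> ^ n = sgn t * \<bar>t\<bar> ^ Suc n"
    by (simp add: sgn_mult_abs mult.assoc[symmetric])
  then show ?thesis by (simp only: root_sgn_power zero_less_Suc)
qed

lemma mult_abs_power_root_Suc: "root (Suc n) t * \<bar>root (Suc n) t\<bar> ^ n = t"
proof -
  have "root (Suc n) t * \<bar>root (Suc n) t\<bar> ^ n = sgn (root (Suc n) t) * \<bar>root (Suc n) t\<bar> ^ Suc n"
    by (simp add: sgn_mult_abs mult.assoc[symmetric])
  then show ?thesis by (simp only: sgn_power_root zero_less_Suc)
qed

theorem proposition4:
  assumes "infinite (UNIV :: 'g set)"
  shows "\<exists>f :: 'g ell1_dual \<Rightarrow> 'g ell1_dual.
    homeomorphic_map weak_star_ball weak_star_ball f \<and>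
    \<not> continuous_on (cball 0 1) f \<and>
    (\<exists>(x :: nat \<Rightarrow> 'g ell1_dual) x'.
      (\<forall>n. x n \<in> cball 0 1) \<and> x' \<in> cball 0 1 \<and>
      limitin weak_star_topology x x' sequentially \<and>
      (\<lambda>n. norm (x n)) \<longlonglongrightarrow> norm x' \<and>
      \<not> (\<lambda>n. norm (f (x n))) \<longlonglongrightarrow> norm (f x'))"
proof -
  obtain e :: "nat \<Rightarrow> 'g" where e: "inj e"
    using assms infinite_countable_subset by blast
  \<comment> \<open>On the range of \<open>e\<close>, \<open>inv e\<close> recovers the position;
    elsewhere it is some unspecified natural number, which is harmless because every such root is a
    homeomorphism of [-1, 1]. \<open>Suc\<close> avoids the degenerate
    \<open>root 0\<close>.\<close>
  define p where "p i = root (Suc (inv e i))" for i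
  define q where "q i t = t * \<bar>t\<bar> ^ inv e i" for i and t :: real
  define f where "f = coordinatewise p"
  \<comment> \<open>The entry is the power whose root of degree \<open>Suc n\<close> is exactly 1/2,
    so \<open>x n\<close> shrinks to 0 while its image does not.\<close>
  define x where "x n = ell1_functional (\<lambda>i. if i = e n then (1 / 2) ^ Suc n else 0)" for n
  have p: "\<bar>p i t\<bar> \<le> 1" if "\<bar>t\<bar> \<le> 1" for i t
    using that by (simp add: p_def real_root_abs[symmetric])
  have q: "\<bar>q i t\<bar> \<le> 1" if "\<bar>t\<bar> \<le> 1" for i t
    using that by (simp add: q_def abs_mult mult_le_one power_le_one)
  have homeo: "homeomorphic_map weak_star_ball weak_star_ball f"
    unfolding f_def
  proof (rule homeomorphic_map_coordinatewise[OF p q])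
    show "q i (p i t) = t" "p i (q i t) = t" for i t
      by (simp_all only: p_def q_def root_Suc_mult_abs_power mult_abs_power_root_Suc)
    show "continuous_on UNIV (p i)" "continuous_on UNIV (q i)" for i
      unfolding p_def q_def by (intro continuous_intros)+
  qed
  have abs_le: "\<bar>if i = e n then (1 / 2) ^ Suc n else 0\<bar> \<le> (1 / 2 :: real) ^ Suc n" for i n
    by simp
  have norm_x: "norm (x n) \<le> (1 / 2) ^ Suc n" for n
    unfolding x_def by (rule norm_ell1_functional_le[OF abs_le])
  have x_ball: "norm (x n) \<le> 1" for n
    using norm_x by (rule order_trans) (simp add: power_le_one del: power_Suc)
  have x_lim: "x \<longlonglongrightarrow> 0"
    by (rule Lim_null_comparison[OF always_eventually LIMSEQ_Suc[OF LIMSEQ_power_zero[of "1 / 2"]]])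
      (simp_all add: norm_x del: power_Suc)
  have f_0: "f 0 = 0"
    by (rule ell1_dual_eqI) (simp add: f_def coordinatewise_unit[OF p], simp add: p_def)
  \<comment> \<open>Evaluation at the unit vector of position \<open>e n\<close>, which has norm 1,
    bounds the norm of the image from below.\<close>
  have norm_f_x: "1 / 2 \<le> norm (f (x n))" for n
  proof -
    have "blinfun_apply (f (x n)) (ell1_unit (e n)) = root (Suc n) ((1 / 2) ^ Suc n)"
      using x_ball[of n] e
      by (simp add: f_def coordinatewise_unit[OF p] p_def x_def ell1_functional_unit[OF abs_le]
          del: power_Suc)
    also have "\<dots> = 1 / 2"
      by (rule real_root_power_cancel) auto
    finally show ?thesis
      using abs_apply_ell1_unit_le[of "f (x n)" "e n"] by simp
  qed
  have not_lim: "\<not> (\<lambda>n. norm (f (x n))) \<longlonglongrightarrow> norm (f 0)"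
    using LIMSEQ_le_const[of "\<lambda>n. norm (f (x n))" 0 "1 / 2"] norm_f_x by (auto simp: f_0)
  \<comment> \<open>The same sequence serves here: it tends to 0 in norm, so norm continuity would
    force the norms of the images to converge to \<open>norm (f 0)\<close>.\<close>
  have "\<not> continuous_on (cball 0 1) f"
  proof
    assume "continuous_on (cball 0 1) f"
    from continuous_on_tendsto_compose[OF this x_lim] x_ball
    have "(\<lambda>n. f (x n)) \<longlonglongrightarrow> f 0" by simp
    then show False using not_lim tendsto_norm by blast
  qed
  \<comment> \<open>Norm convergence passes to the coarser weak-star topology.\<close>
  moreover have "limitin weak_star_topology x 0 sequentially"
    using continuous_map_limit[OF strong_operator_topology_weaker_than_euclidean, of x 0 sequentially]
      x_lim by (simp add: o_def)
  moreover have "(\<lambda>n. norm (x n)) \<longlonglongrightarrow> norm (0 :: 'g ell1_dual)"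
    using x_lim by (rule tendsto_norm)
  ultimately show ?thesis
    using homeo not_lim x_ball by (intro exI[of _ f] exI[of _ x] exI[of _ 0] conjI) auto
qed

end
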